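(* Let $n\ge 4$ be an integer, let $s=\frac{n-2}{2}$ if $n$ is even and $s=\frac{n-3}{2}$ if $n$ is odd, and consider the planar differential equation $$z'=\epsilon z+z\sum_{k=1}^{s}A_k|z|^{2k}+B\bar z^{\,n-1},\qquad z=x+iy,$$ with $\epsilon=\epsilon_1+i\epsilon_2$, $A_k=A_k^{(1)}+iA_k^{(2)}$, and $B\ge 0$ real. If $$\epsilon_1=0,\qquad A_k^{(1)}=0,\quad k=1,\dots,s,$$ then the equation is Hamiltonian and can be written in polar coordinates $z=re^{i\varphi}$ in the form $$r'=B\,r^{n-1}\cos(n\varphi)=-\frac1r\frac{\partial H}{\partial\varphi},\qquad \varphi'=\epsilon_2+\sum_{k=1}^{s}A_k^{(2)}r^{2k}-B\,r^{n-2}\sin(n\varphi)=\frac1r\frac{\partial H}{\partial r},$$ with Hamiltonian $$H(r,\varphi)=\epsilon_2\frac{r^2}{2}+\sum_{k=1}^{s}A_k^{(2)}\frac{r^{2k+2}}{2k+2}-B\frac{r^n}{n}\sin(n\varphi)+h,$$ where $h$ is an arbitrary constant.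
   Context: $A_k^{(1)},A_k^{(2)}$ are the real and imaginary parts of $A_k$. For a general complex coefficient $B_1+iB_2$ of $\bar z^{\,n-1}$, a rotation of the phase plane replaces it by the real number $B=\sqrt{B_1^2+B_2^2}$; the equation is written in these rotated coordinates. A planar system is Hamiltonian if it has the form $x'=-\partial H/\partial y$, $y'=\partial H/\partial x$ for some function $H$. *)

theory Defs
  imports "HOL-Analysis.Analysis"
begin

definition resonance_field ::
    "nat \<Rightarrow> nat \<Rightarrow> complex \<Rightarrow> (nat \<Rightarrow> complex) \<Rightarrow> real \<Rightarrow> complex \<Rightarrow> complex" where
  "resonance_field n s \<epsilon> A B z =
     \<epsilon> * z + z * (\<Sum>k=1..s. A k * complex_of_real (cmod z ^ (2 * k)))
       + complex_of_real B * cnj z ^ (n - 1)"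

definition solution_on :: "(complex \<Rightarrow> complex) \<Rightarrow> real set \<Rightarrow> (real \<Rightarrow> complex) \<Rightarrow> bool" where
  "solution_on F I z \<longleftrightarrow> (\<forall>t\<in>I. (z has_vector_derivative F (z t)) (at t))"

text \<open>The system is \<open>x' = Re (F (x + iy))\<close>, \<open>y' = Im (F (x + iy))\<close>; the two derivatives
  are the partial derivatives of \<open>H\<close> in \<open>y\<close> and in \<open>x\<close>.\<close>
definition is_Hamiltonian_of :: "(real \<Rightarrow> real \<Rightarrow> real) \<Rightarrow> (complex \<Rightarrow> complex) \<Rightarrow> bool" where
  "is_Hamiltonian_of H F \<longleftrightarrow>
     (\<forall>x y. \<exists>Hx Hy. ((\<lambda>u. H u y) has_real_derivative Hx) (at x) \<and>
                    ((\<lambda>v. H x v) has_real_derivative Hy) (at y) \<and>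
                    Re (F (Complex x y)) = - Hy \<and>
                    Im (F (Complex x y)) = Hx)"

definition Hamiltonian_field :: "(complex \<Rightarrow> complex) \<Rightarrow> bool" where
  "Hamiltonian_field F \<longleftrightarrow> (\<exists>H. is_Hamiltonian_of H F)"

text \<open>\<open>z' = F z\<close> reads \<open>r' = R r \<phi>\<close>, \<open>\<phi>' = \<Phi> r \<phi>\<close> under \<open>z = r exp (i\<phi>)\<close>, away from the origin.
  Only continuity of \<open>r\<close> and \<open>\<phi>\<close> is presupposed, so every continuous choice of polar
  coordinates along a nonvanishing solution is covered.\<close>
definition has_polar_form ::
    "(complex \<Rightarrow> complex) \<Rightarrow> (real \<Rightarrow> real \<Rightarrow> real) \<Rightarrow> (real \<Rightarrow> real \<Rightarrow> real) \<Rightarrow> bool" where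
  "has_polar_form F R \<Phi> \<longleftrightarrow>
     (\<forall>I r \<phi>. open I \<and> is_interval I \<and> continuous_on I r \<and> continuous_on I \<phi> \<and> (\<forall>t\<in>I. r t > 0) \<longrightarrow>
        (solution_on F I (\<lambda>t. complex_of_real (r t) * exp (\<i> * complex_of_real (\<phi> t))) \<longleftrightarrow>
         (\<forall>t\<in>I. (r has_real_derivative R (r t) (\<phi> t)) (at t) \<and>
                (\<phi> has_real_derivative \<Phi> (r t) (\<phi> t)) (at t))))"

definition is_polar_Hamiltonian_of ::
    "(real \<Rightarrow> real \<Rightarrow> real) \<Rightarrow> (real \<Rightarrow> real \<Rightarrow> real) \<Rightarrow> (real \<Rightarrow> real \<Rightarrow> real) \<Rightarrow> bool" where
  "is_polar_Hamiltonian_of H R \<Phi> \<longleftrightarrow>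
     (\<forall>r>0. \<forall>\<phi>. \<exists>Hr H\<phi>. ((\<lambda>\<rho>. H \<rho> \<phi>) has_real_derivative Hr) (at r) \<and>
                       ((\<lambda>\<psi>. H r \<psi>) has_real_derivative H\<phi>) (at \<phi>) \<and>
                       R r \<phi> = - (1 / r) * H\<phi> \<and>
                       \<Phi> r \<phi> = (1 / r) * Hr)"

definition radial_rate :: "nat \<Rightarrow> real \<Rightarrow> real \<Rightarrow> real \<Rightarrow> real" where
  "radial_rate n B r \<phi> = B * r ^ (n - 1) * cos (real n * \<phi>)"

definition angular_rate ::
    "nat \<Rightarrow> nat \<Rightarrow> real \<Rightarrow> (nat \<Rightarrow> real) \<Rightarrow> real \<Rightarrow> real \<Rightarrow> real \<Rightarrow> real" where
  "angular_rate n s \<epsilon>2 A2 B r \<phi> =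
     \<epsilon>2 + (\<Sum>k=1..s. A2 k * r ^ (2 * k)) - B * r ^ (n - 2) * sin (real n * \<phi>)"

definition polar_Hamiltonian ::
    "nat \<Rightarrow> nat \<Rightarrow> real \<Rightarrow> (nat \<Rightarrow> real) \<Rightarrow> real \<Rightarrow> real \<Rightarrow> real \<Rightarrow> real \<Rightarrow> real" where
  "polar_Hamiltonian n s \<epsilon>2 A2 B h r \<phi> =
     \<epsilon>2 * (r ^ 2 / 2) + (\<Sum>k=1..s. A2 k * (r ^ (2 * k + 2) / real (2 * k + 2)))
       - B * (r ^ n / real n) * sin (real n * \<phi>) + h"

end

theory Submission
  imports Defs
begin

text \<open>On the imaginary axis of the parameters the field is \<open>z \<mapsto> \<i> z g(|z|\<^sup>2) + B (cnj z)\<^sup>n\<^sup>-\<^sup>1\<close>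
  with \<open>g\<close> real. The first summand is the rotation generated by a radial Hamiltonian; the second
  one is the Hamiltonian field of \<open>- (B / n) Im (z\<^sup>n)\<close>, because \<open>z\<^sup>n\<close> is holomorphic.
  Factoring out \<open>exp (\<i> \<phi>)\<close> gives the polar equations. That continuous polar
  coordinates of a differentiable curve are differentiable follows by locally taking a logarithm of
  the curve, rotated into the right half plane.\<close>

section \<open>Differentiability of polar coordinates along a curve\<close>

text \<open>In the frame turned by \<open>\<phi> t\<close>, \<open>a\<close> is the radial and
  \<open>r t * b\<close> the tangential velocity. From right to left this is the product rule. The
  converse must exclude jumps of \<phi> by multiples of 2 pi, which the curve cannot detect;
  continuity at \<open>t\<close> does so.\<close>

lemma has_vector_derivative_polar_iff:
  fixes r \<phi> :: "real \<Rightarrow> real"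
  assumes cont: "isCont \<phi> t" and pos: "\<forall>\<^sub>F u in nhds t. r u > 0"
  shows "((\<lambda>u. of_real (r u) * exp (\<i> * of_real (\<phi> u))) has_vector_derivative
            exp (\<i> * of_real (\<phi> t)) * Complex a (r t * b)) (at t)
     \<longleftrightarrow> (r has_real_derivative a) (at t) \<and> (\<phi> has_real_derivative b) (at t)"
    (is "(?z has_vector_derivative ?v) _ \<longleftrightarrow> ?R")
proof
  assume ?R
  then have r: "((\<lambda>u. complex_of_real (r u)) has_vector_derivative of_real a) (at t)"
    and p: "((\<lambda>u. \<i> * complex_of_real (\<phi> u)) has_vector_derivative \<i> * of_real b) (at t)"
    by (auto intro!: has_vector_derivative_of_real has_vector_derivative_mult_right)
  have "((exp \<circ> (\<lambda>u. \<i> * complex_of_real (\<phi> u))) has_vector_derivative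
      (\<i> * of_real b) * exp (\<i> * of_real (\<phi> t))) (at t)"
    by (rule field_vector_diff_chain_at[OF p DERIV_exp])
  from has_vector_derivative_mult[OF r this[unfolded o_def]]
  show "(?z has_vector_derivative ?v) (at t)"
    by (simp add: Complex_eq algebra_simps)
next
  assume z: "(?z has_vector_derivative ?v) (at t)"
  have rt: "r t > 0"
    using pos by (rule eventually_nhds_x_imp_x)
  \<comment> \<open>Turning by \<open>- \<phi> t\<close> puts \<open>w t\<close> on the positive
    real axis, off the branch cut of \<open>Ln\<close>.\<close>
  define w where "w u = exp (- \<i> * of_real (\<phi> t)) * ?z u" for u
  have w_eq: "w u = of_real (r u) * exp (\<i> * of_real (\<phi> u - \<phi> t))" for u
    by (simp add: w_def exp_diff exp_minus right_diff_distrib divide_inverse)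
  have wt: "w t = of_real (r t)"
    by (simp add: w_eq)
  have "(w has_vector_derivative exp (- \<i> * of_real (\<phi> t)) * ?v) (at t)"
    unfolding w_def by (rule has_vector_derivative_mult_right[OF z])
  then have w: "(w has_vector_derivative Complex a (r t * b)) (at t)"
    by (simp add: mult.assoc[symmetric] exp_add[symmetric])
  have "(Ln has_field_derivative inverse (w t)) (at (w t))"
    using rt by (intro has_field_derivative_Ln) (simp add: wt)
  from field_vector_diff_chain_at[OF w this]
  have "((\<lambda>u. Ln (w u)) has_vector_derivative Complex a (r t * b) / of_real (r t)) (at t)"
    by (simp add: o_def wt divide_inverse)
  also have "Complex a (r t * b) / of_real (r t) = Complex (a / r t) b"
    using rt by (simp add: complex_eq_iff)
  finally have Lnw: "((\<lambda>u. Ln (w u)) has_vector_derivative Complex (a / r t) b) (at t)" .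
  \<comment> \<open>The bound pi keeps \<open>\<phi> u - \<phi> t\<close> in the strip where
    \<open>Ln\<close> inverts \<open>exp\<close>; hence near \<open>t\<close> the real and imaginary
    parts of \<open>Ln (w u)\<close> are \<open>ln (r u)\<close> and this angle increment.\<close>
  have "\<forall>\<^sub>F u in nhds t. dist (\<phi> u) (\<phi> t) < pi"
    using cont pi_gt_zero unfolding continuous_at tendsto_at_iff_tendsto_nhds
    by (rule tendstoD)
  with pos have ev: "\<forall>\<^sub>F u in nhds t. Ln (w u) = Complex (ln (r u)) (\<phi> u - \<phi> t) \<and> r u > 0"
  proof eventually_elim
    case (elim u)
    have "w u = exp (Complex (ln (r u)) (\<phi> u - \<phi> t))"
      using elim by (simp add: w_eq Complex_eq exp_add exp_of_real)
    then show ?case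
      using elim by (simp add: Ln_exp dist_real_def)
  qed
  have "((\<lambda>u. Re (Ln (w u))) has_vector_derivative a / r t) (at t)"
    using bounded_linear.has_vector_derivative[OF bounded_linear_Re Lnw] by simp
  then have "((\<lambda>u. exp (Re (Ln (w u)))) has_real_derivative exp (Re (Ln (w t))) * (a / r t)) (at t)"
    unfolding has_real_derivative_iff_has_vector_derivative[symmetric]
    by (rule DERIV_fun_exp)
  then have "((\<lambda>u. exp (Re (Ln (w u)))) has_real_derivative a) (at t)"
    using rt by (simp add: wt)
  moreover have "\<forall>\<^sub>F u in nhds t. exp (Re (Ln (w u))) = r u"
    using ev by eventually_elim simp
  ultimately have r: "(r has_real_derivative a) (at t)"
    by (simp only: DERIV_cong_ev[OF refl _ refl])
  have "((\<lambda>u. Im (Ln (w u))) has_real_derivative b) (at t)"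
    unfolding has_real_derivative_iff_has_vector_derivative
    using bounded_linear.has_vector_derivative[OF bounded_linear_Im Lnw] by simp
  then have "((\<lambda>u. \<phi> t + Im (Ln (w u))) has_real_derivative b) (at t)"
    using DERIV_add[OF DERIV_const] by fastforce
  moreover have "\<forall>\<^sub>F u in nhds t. \<phi> t + Im (Ln (w u)) = \<phi> u"
    using ev by eventually_elim simp
  ultimately have "(\<phi> has_real_derivative b) (at t)"
    by (simp only: DERIV_cong_ev[OF refl _ refl])
  with r show ?R ..
qed

text \<open>Reduces the claim about curves to a pointwise identity of the field in the rotating
  frame. Openness of \<open>I\<close> supplies the neighbourhood of each time on which r is
  positive.\<close>

lemma has_polar_formI:
  assumes "\<And>r \<phi>. r > 0 \<Longrightarrow>
    F (of_real r * exp (\<i> * of_real \<phi>)) = exp (\<i> * of_real \<phi>) * Complex (R r \<phi>) (r * \<Phi> r \<phi>)"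
  shows "has_polar_form F R \<Phi>"
  unfolding has_polar_form_def solution_on_def
proof (intro allI impI ball_cong refl, elim conjE)
  fix I :: "real set" and r \<phi> :: "real \<Rightarrow> real" and t
  assume I: "open I" "t \<in> I" and cont: "continuous_on I \<phi>" and pos: "\<forall>t\<in>I. r t > 0"
  have "isCont \<phi> t"
    using cont I by (simp add: continuous_on_eq_continuous_at)
  moreover have "\<forall>\<^sub>F u in nhds t. r u > 0"
    using I pos by (auto simp: eventually_nhds)
  ultimately show "((\<lambda>t. of_real (r t) * exp (\<i> * of_real (\<phi> t))) has_vector_derivative
        F (of_real (r t) * exp (\<i> * of_real (\<phi> t)))) (at t) \<longleftrightarrow>
      (r has_real_derivative R (r t) (\<phi> t)) (at t) \<and>
      (\<phi> has_real_derivative \<Phi> (r t) (\<phi> t)) (at t)"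
    using has_vector_derivative_polar_iff assms pos I by simp
qed

section \<open>The Cartesian Hamiltonian and the field with imaginary coefficients\<close>

text \<open>A polynomial in \<open>x\<close> and \<open>y\<close>, hence differentiable at the
  origin too, where polar coordinates fail but \<open>is_Hamiltonian_of\<close> still demands
  partial derivatives. \<open>Im (Complex x y ^ n)\<close> stands for r^n sin(n \<phi>).\<close>

definition cartesian_Hamiltonian ::
    "nat \<Rightarrow> nat \<Rightarrow> real \<Rightarrow> (nat \<Rightarrow> real) \<Rightarrow> real \<Rightarrow> real \<Rightarrow> real \<Rightarrow> real \<Rightarrow> real" where
  "cartesian_Hamiltonian n s \<epsilon>2 A2 B h x y =
     \<epsilon>2 * ((x\<^sup>2 + y\<^sup>2) / 2) + (\<Sum>k=1..s. A2 k * ((x\<^sup>2 + y\<^sup>2) ^ (k + 1) / real (2 * k + 2)))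
       - B / real n * Im (Complex x y ^ n) + h"

lemma cartesian_Hamiltonian_polar:
  "cartesian_Hamiltonian n s \<epsilon>2 A2 B h (r * cos \<phi>) (r * sin \<phi>)
     = polar_Hamiltonian n s \<epsilon>2 A2 B h r \<phi>"
proof -
  have "(r * cos \<phi>)\<^sup>2 + (r * sin \<phi>)\<^sup>2 = r\<^sup>2"
    by (simp add: power_mult_distrib flip: distrib_left)
  moreover have "(r\<^sup>2) ^ (k + 1) = r ^ (2 * k + 2)" for k
    by (simp flip: power_mult power_add add: algebra_simps)
  moreover have "Complex (r * cos \<phi>) (r * sin \<phi>) = rcis r \<phi>"
    by (simp add: complex_eq_iff)
  ultimately show ?thesis
    by (simp add: cartesian_Hamiltonian_def polar_Hamiltonian_def DeMoivre2)
qed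

text \<open>The common starting point of the polar and the Cartesian computation: a real angular
  velocity depending on \<open>cmod z\<close> alone, plus the conjugate of a holomorphic
  power.\<close>

lemma resonance_field_imaginary:
  assumes "Re \<epsilon> = 0" "\<forall>k\<in>{1..s}. Re (A k) = 0"
  shows "resonance_field n s \<epsilon> A B z =
    \<i> * z * of_real (Im \<epsilon> + (\<Sum>k=1..s. Im (A k) * cmod z ^ (2 * k))) + of_real B * cnj (z ^ (n - 1))"
proof -
  have "\<epsilon> = \<i> * of_real (Im \<epsilon>)"
    using assms(1) by (simp add: complex_eq_iff)
  moreover have "(\<Sum>k=1..s. A k * of_real (cmod z ^ (2 * k)))
      = \<i> * of_real (\<Sum>k=1..s. Im (A k) * cmod z ^ (2 * k))"
    unfolding of_real_sum sum_distrib_left using assms(2)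
    by (intro sum.cong) (auto simp: complex_eq_iff)
  ultimately show ?thesis
    unfolding resonance_field_def by (simp add: algebra_simps)
qed

lemma resonance_field_polar:
  assumes "n \<ge> 2" "Re \<epsilon> = 0" "\<forall>k\<in>{1..s}. Re (A k) = 0" "r > 0"
  shows "resonance_field n s \<epsilon> A B (of_real r * exp (\<i> * of_real \<phi>)) =
    exp (\<i> * of_real \<phi>) *
      Complex (radial_rate n B r \<phi>) (r * angular_rate n s (Im \<epsilon>) (\<lambda>k. Im (A k)) B r \<phi>)"
proof -
  obtain m where n: "n = Suc (Suc m)"
    using assms(1) by (metis add_2_eq_Suc le_Suc_ex)
  have z: "of_real r * exp (\<i> * of_real \<phi>) = rcis r \<phi>"
    by (simp add: rcis_def cis_conv_exp)
  have pow: "r ^ (n - 1) = r * r ^ (n - 2)"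
    by (simp add: n)
  \<comment> \<open>Splitting the phase as -(n-1) = 1 - n frees the factor \<open>cis \<phi>\<close>
    shared with the rotation term and leaves the angle n \<phi>.\<close>
  have "cnj (rcis r \<phi> ^ (n - 1)) = of_real (r ^ (n - 1)) * (cis \<phi> * cis (- (real n * \<phi>)))"
    unfolding DeMoivre2 by (simp add: rcis_def cis_mult cis_cnj n algebra_simps)
  then have "resonance_field n s \<epsilon> A B (rcis r \<phi>) = cis \<phi> *
      (\<i> * of_real (r * (Im \<epsilon> + (\<Sum>k=1..s. Im (A k) * r ^ (2 * k))))
        + of_real (B * r ^ (n - 1)) * cis (- (real n * \<phi>)))"
    using assms(4) unfolding resonance_field_imaginary[OF assms(2,3)]
    by (simp add: rcis_def norm_mult algebra_simps)
  also have "\<i> * of_real (r * (Im \<epsilon> + (\<Sum>k=1..s. Im (A k) * r ^ (2 * k))))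
        + of_real (B * r ^ (n - 1)) * cis (- (real n * \<phi>))
      = Complex (radial_rate n B r \<phi>) (r * angular_rate n s (Im \<epsilon>) (\<lambda>k. Im (A k)) B r \<phi>)"
    by (simp add: complex_eq_iff radial_rate_def angular_rate_def pow algebra_simps
        del: One_nat_def)
  finally show ?thesis
    by (simp add: z cis_conv_exp)
qed

section \<open>Hamilton's equations in Cartesian and in polar coordinates\<close>

lemma is_Hamiltonian_of_cartesian_Hamiltonian:
  assumes "n > 0" "Re \<epsilon> = 0" "\<forall>k\<in>{1..s}. Re (A k) = 0"
  shows "is_Hamiltonian_of (cartesian_Hamiltonian n s (Im \<epsilon>) (\<lambda>k. Im (A k)) B h)
           (resonance_field n s \<epsilon> A B)"
  unfolding is_Hamiltonian_of_def
proof (intro allI exI conjI)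
  fix x y :: real
  define q where "q = x\<^sup>2 + y\<^sup>2"
  define g where "g = Im \<epsilon> + (\<Sum>k=1..s. Im (A k) * q ^ k)"
  define P where "P = Complex x y ^ (n - 1)"
  \<comment> \<open>Here \<open>f\<close> is the squared radius along a coordinate line, so
    \<open>c\<close> will be \<open>x\<close> or \<open>y\<close> and one computation gives both
    partial derivatives. The denominators \<open>2 * k + 2\<close> cancel the exponent
    \<open>k + 1\<close> times the 2 in \<open>2 * c\<close>.\<close>
  have potential: "((\<lambda>u. Im \<epsilon> * (f u / 2)
        + (\<Sum>k=1..s. Im (A k) * (f u ^ (k + 1) / real (2 * k + 2)))) has_real_derivative c * g) (at a)"
    if "(f has_real_derivative 2 * c) (at a)" "f a = q" for f c a
  proof -
    have "((\<lambda>u. f u ^ (k + 1) / real (2 * k + 2)) has_real_derivative q ^ k * c) (at a)" for k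
    proof -
      have "((\<lambda>u. f u ^ (k + 1)) has_real_derivative real (2 * k + 2) * (q ^ k * c)) (at a)"
        using DERIV_power[OF that(1), of "k + 1"] that(2) by (simp add: algebra_simps)
      from DERIV_cdivide[OF this, of "real (2 * k + 2)"] show ?thesis
        by (subst (asm) nonzero_mult_div_cancel_left) simp_all
    qed
    then have "((\<lambda>u. Im \<epsilon> * (f u / 2)
        + (\<Sum>k=1..s. Im (A k) * (f u ^ (k + 1) / real (2 * k + 2)))) has_real_derivative
          Im \<epsilon> * (2 * c / 2) + (\<Sum>k=1..s. Im (A k) * (q ^ k * c))) (at a)"
      by (intro DERIV_add DERIV_cmult DERIV_sum DERIV_cdivide that)
    then show ?thesis
      by (simp add: g_def algebra_simps sum_distrib_left)
  qed
  \<comment> \<open>The complex chain rule along a coordinate line with direction \<open>d\<close>: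
    taking \<open>d\<close> as 1 and as \<i> yields the partial derivatives \<open>B * Im P\<close>
    and \<open>B * Re P\<close>.\<close>
  have harmonic: "((\<lambda>u. B / real n * Im (f u ^ n)) has_real_derivative B * Im (P * d)) (at a)"
    if "(f has_vector_derivative d) (at a)" "f a = Complex x y" for f d a
  proof -
    have "((\<lambda>w. w ^ n) has_field_derivative of_nat n * P) (at (f a))"
      unfolding that P_def by (rule derivative_eq_intros refl)+ simp
    from field_vector_diff_chain_at[OF that(1) this]
    have "((\<lambda>u. f u ^ n) has_vector_derivative d * (of_nat n * P)) (at a)"
      by (simp add: o_def)
    from bounded_linear.has_vector_derivative[OF bounded_linear_Im this]
    have "((\<lambda>u. Im (f u ^ n)) has_real_derivative Im (d * (of_nat n * P))) (at a)"
      by (simp only: has_real_derivative_iff_has_vector_derivative)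
    from DERIV_cmult[OF this, of "B / real n"]
    have "((\<lambda>u. B / real n * Im (f u ^ n)) has_real_derivative
        B / real n * (real n * Im (P * d))) (at a)"
      by (simp add: algebra_simps)
    then show ?thesis
      using assms(1) by simp
  qed
  have "((\<lambda>u. Complex u y) has_vector_derivative 1) (at x)"
    unfolding Complex_eq by (auto intro!: derivative_eq_intros)
  from harmonic[OF this] have hx: "((\<lambda>u. B / real n * Im (Complex u y ^ n)) has_real_derivative B * Im P) (at x)"
    by simp
  have "((\<lambda>v. Complex x v) has_vector_derivative \<i>) (at y)"
    unfolding Complex_eq by (auto intro!: derivative_eq_intros)
  from harmonic[OF this] have hy: "((\<lambda>v. B / real n * Im (Complex x v ^ n)) has_real_derivative B * Re P) (at y)"
    by simp
  have px: "((\<lambda>u. u\<^sup>2 + y\<^sup>2) has_real_derivative 2 * x) (at x)"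
    and py: "((\<lambda>v. x\<^sup>2 + v\<^sup>2) has_real_derivative 2 * y) (at y)"
    by (auto intro!: derivative_eq_intros)
  show "((\<lambda>u. cartesian_Hamiltonian n s (Im \<epsilon>) (\<lambda>k. Im (A k)) B h u y)
      has_real_derivative x * g - B * Im P) (at x)"
    unfolding cartesian_Hamiltonian_def
    using DERIV_add[OF DERIV_diff[OF potential[OF px] hx] DERIV_const] by (simp add: q_def)
  show "((\<lambda>v. cartesian_Hamiltonian n s (Im \<epsilon>) (\<lambda>k. Im (A k)) B h x v)
      has_real_derivative y * g - B * Re P) (at y)"
    unfolding cartesian_Hamiltonian_def
    using DERIV_add[OF DERIV_diff[OF potential[OF py] hy] DERIV_const] by (simp add: q_def)
  have F: "resonance_field n s \<epsilon> A B (Complex x y) = \<i> * Complex x y * of_real g + of_real B * cnj P"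
    unfolding resonance_field_imaginary[OF assms(2,3)] g_def P_def q_def
    by (simp add: power_mult cmod_power2)
  show "Re (resonance_field n s \<epsilon> A B (Complex x y)) = - (y * g - B * Re P)"
    and "Im (resonance_field n s \<epsilon> A B (Complex x y)) = x * g - B * Im P"
    unfolding F by (simp_all add: algebra_simps)
qed

lemma is_polar_Hamiltonian_of_polar_Hamiltonian:
  assumes "n \<ge> 2"
  shows "is_polar_Hamiltonian_of (polar_Hamiltonian n s \<epsilon>2 A2 B h)
           (radial_rate n B) (angular_rate n s \<epsilon>2 A2 B)"
  unfolding is_polar_Hamiltonian_of_def
proof (intro allI impI exI conjI)
  fix r \<phi> :: real
  assume r: "r > 0"
  obtain m where n: "n = Suc (Suc m)"
    using assms by (metis add_2_eq_Suc le_Suc_ex)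
  have pow: "((\<lambda>\<rho>. \<rho> ^ Suc k / real (Suc k)) has_real_derivative r ^ k) (at r)" for k
    using DERIV_cdivide[OF DERIV_pow[of "Suc k"], of "real (Suc k)"] by (simp del: of_nat_Suc)
  have "((\<lambda>\<rho>. \<rho> ^ 2 / 2) has_real_derivative r) (at r)"
    "((\<lambda>\<rho>. \<rho> ^ (2 * k + 2) / real (2 * k + 2)) has_real_derivative r ^ (2 * k + 1)) (at r)"
    "((\<lambda>\<rho>. \<rho> ^ n / real n) has_real_derivative r ^ (n - 1)) (at r)" for k
    using pow[of 1] pow[of "2 * k + 1"] pow[of "n - 1"] by (simp_all add: n numeral_2_eq_2)
  \<comment> \<open>The final \<open>+ 0\<close> is the derivative of the constant \<open>h\<close>,
    kept so that the goal has the shape of the sum rule.\<close>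
  then show "((\<lambda>\<rho>. polar_Hamiltonian n s \<epsilon>2 A2 B h \<rho> \<phi>) has_real_derivative
      \<epsilon>2 * r + (\<Sum>k=1..s. A2 k * r ^ (2 * k + 1)) - B * r ^ (n - 1) * sin (real n * \<phi>) + 0) (at r)"
    unfolding polar_Hamiltonian_def
    by (intro DERIV_add DERIV_diff DERIV_sum DERIV_cmult DERIV_cmult_right DERIV_const)
  show "((\<lambda>\<psi>. polar_Hamiltonian n s \<epsilon>2 A2 B h r \<psi>) has_real_derivative
      - B * r ^ n * cos (real n * \<phi>)) (at \<phi>)"
    unfolding polar_Hamiltonian_def using n by (auto intro!: derivative_eq_intros)
  show "radial_rate n B r \<phi> = - (1 / r) * (- B * r ^ n * cos (real n * \<phi>))"
    using r by (simp add: radial_rate_def n)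
  show "angular_rate n s \<epsilon>2 A2 B r \<phi> = (1 / r) *
      (\<epsilon>2 * r + (\<Sum>k=1..s. A2 k * r ^ (2 * k + 1)) - B * r ^ (n - 1) * sin (real n * \<phi>) + 0)"
    using r by (simp add: angular_rate_def n field_simps sum_distrib_left)
qed

theorem proposition2:
  fixes n s :: nat and \<epsilon> :: complex and A :: "nat \<Rightarrow> complex" and B :: real
  assumes "n \<ge> 4"
    and "s = (if even n then (n - 2) div 2 else (n - 3) div 2)"
    and "B \<ge> 0"
    and "Re \<epsilon> = 0"
    and "\<forall>k\<in>{1..s}. Re (A k) = 0"
  shows "Hamiltonian_field (resonance_field n s \<epsilon> A B)
    \<and> has_polar_form (resonance_field n s \<epsilon> A B)
        (radial_rate n B) (angular_rate n s (Im \<epsilon>) (\<lambda>k. Im (A k)) B)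
    \<and> (\<forall>h. is_polar_Hamiltonian_of (polar_Hamiltonian n s (Im \<epsilon>) (\<lambda>k. Im (A k)) B h)
              (radial_rate n B) (angular_rate n s (Im \<epsilon>) (\<lambda>k. Im (A k)) B)
          \<and> (\<exists>H. is_Hamiltonian_of H (resonance_field n s \<epsilon> A B)
               \<and> (\<forall>r\<ge>0. \<forall>\<phi>. H (r * cos \<phi>) (r * sin \<phi>) =
                     polar_Hamiltonian n s (Im \<epsilon>) (\<lambda>k. Im (A k)) B h r \<phi>)))"
proof -
  have n: "n > 0" "n \<ge> 2"
    using assms(1) by simp_all
  \<comment> \<open>\<open>h\<close> stays free here: for each \<open>h\<close> the witness is
    \<open>cartesian_Hamiltonian\<close> with that same constant.\<close>
  note H = is_Hamiltonian_of_cartesian_Hamiltonian[OF n(1) assms(4,5)]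
  have "Hamiltonian_field (resonance_field n s \<epsilon> A B)"
    unfolding Hamiltonian_field_def using H by blast
  moreover have "has_polar_form (resonance_field n s \<epsilon> A B)
      (radial_rate n B) (angular_rate n s (Im \<epsilon>) (\<lambda>k. Im (A k)) B)"
    by (intro has_polar_formI resonance_field_polar n assms(4,5))
  ultimately show ?thesis
    using is_polar_Hamiltonian_of_polar_Hamiltonian[OF n(2)] H cartesian_Hamiltonian_polar by blast
qed

end
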